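(* Let $(X,d,\mu,\mathcal E,\mathcal F)$ be a sub-Gaussian Dirichlet space with parameters $d_H,d_W$, and let $0<\kappa<d_W$. If $X$ satisfies $wBE(\kappa)$, then for every integer $n\ge1$ the product space $(X^n,d_{X^n},\mu^{\otimes n})$, equipped with the product heat kernel $p_t^{X^n}$, also satisfies $wBE(\kappa)$; that is, there is $C>0$ such that for all $t>0$, $f\in L^\infty(X^n,\mu^{\otimes n})$ and $\mathbf x,\mathbf x'\in X^n$, $$|P_t^{X^n}f(\mathbf x)-P_t^{X^n}f(\mathbf x')|\le C\,\frac{d_{X^n}(\mathbf x,\mathbf x')^\kappa}{t^{\kappa/d_W}}\,\|f\|_{L^\infty(X^n,\mu^{\otimes n})}.$$
   Context: A sub-Gaussian Dirichlet space $(X,d,\mu,\mathcal E,\mathcal F)$ with parameters $d_H,d_W$ means: $(X,d,\mu)$ is a locally compact metric measure space, $\mu$ is a Radon measure with support $X$, $(\mathcal E,\mathcal F)$ is a Dirichlet form on $L^2(X,\mu)$, and (i) every ball $B(x,r)=\{y: d(x,y)<r\}$, $x\in X$, $0<r<\infty$, has compact closure; (ii) $\mu$ is Ahlfors $d_H$-regular: there are $c_1,c_2,d_H\in(0,\infty)$ with $c_1r^{d_H}\le\mu(B(x,r))\le c_2r^{d_H}$ for all $x\in X$, $r\in[0,\infty)$; (iii) $\mathcal E$ is regular and strongly local (i.e. $\mathcal E(u,v)=0$ for $u,v\in\mathcal F$ with compact supports such that $u$ is constant in a neighborhood of the support of $v$); (iv) the heat semigroup $\{P_t\}$ of $(\mathcal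 E,\mathcal F)$ has a continuous heat kernel $p_t(x,y)$ (so $P_tg(x)=\int_Xp_t(x,y)g(y)\,d\mu(y)$) satisfying, for some $c_3,c_4,c_5,c_6\in(0,\infty)$ and $d_W\in(2,\infty)$, $$c_5t^{-d_H/d_W}\exp\Big(-c_6\Big(\tfrac{d(x,y)^{d_W}}{t}\Big)^{\frac1{d_W-1}}\Big)\le p_t(x,y)\le c_3t^{-d_H/d_W}\exp\Big(-c_4\Big(\tfrac{d(x,y)^{d_W}}{t}\Big)^{\frac1{d_W-1}}\Big)$$ for $\mu\times\mu$-a.e. $(x,y)$ and all $t>0$. In this setting $P_t1=1$. $X$ satisfies $wBE(\kappa)$ ($0<\kappa<d_W$) if there is $C>0$ such that $|P_tg(x)-P_tg(y)|\le C\frac{d(x,y)^\kappa}{t^{\kappa/d_W}}\|g\|_{L^\infty(X,\mu)}$ for all $t>0$, $g\in L^\infty(X,\mu)$, $x,y\in X$. On $X^n$ the metric is defined by $d_{X^n}(\mathbf x,\mathbf x')^{\frac{d_W}{d_W-1}}=\sum_{i=1}^nd(x_i,x_i')^{\frac{d_W}{d_W-1}}$, the measure is $\mu^{\otimes n}$, the heat kernel is $p_t^{X^n}(\mathbf x,\mathbf y)=p_t(x_1,y_1)\cdots p_t(x_n,y_n)$, and $P_t^{X^n}f(\mathbf x)=\int_{X^n}p_t^{X^n}(\mathbf x,\mathbf y)f(\mathbf y)\,d\mu^{\otimes n}(\mathbf y)$. The space $X^n$ is Ahlfors $nd_H$-regular, and its heat kernel satisfies sub-Gaussian bounds with the same $d_W$.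 *)

theory Defs
  imports "HOL-Analysis.Analysis" "HOL-Probability.Essential_Supremum"
begin

section \<open>Function spaces\<close>

text \<open>Elements of the Lebesgue spaces are represented by measurable functions, so every notion
  below that concerns classes of functions is stated up to almost everywhere equality.\<close>

definition L2 :: "'b measure \<Rightarrow> ('b \<Rightarrow> real) set" where
  "L2 M = {f \<in> borel_measurable M. integrable M (\<lambda>x. (f x)\<^sup>2)}"

definition L2_inner :: "'b measure \<Rightarrow> ('b \<Rightarrow> real) \<Rightarrow> ('b \<Rightarrow> real) \<Rightarrow> real" where
  "L2_inner M f g = (\<integral>x. f x * g x \<partial>M)"

definition L2_norm :: "'b measure \<Rightarrow> ('b \<Rightarrow> real) \<Rightarrow> real" where
  "L2_norm M f = sqrt (L2_inner M f f)"

definition Linf :: "'b measure \<Rightarrow> ('b \<Rightarrow> real) set" where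
  "Linf M = {f \<in> borel_measurable M. esssup M (\<lambda>x. ereal \<bar>f x\<bar>) < \<infinity>}"

definition Linf_norm :: "'b measure \<Rightarrow> ('b \<Rightarrow> real) \<Rightarrow> real" where
  "Linf_norm M f = real_of_ereal (esssup M (\<lambda>x. ereal \<bar>f x\<bar>))"

definition Cc :: "('a::topological_space \<Rightarrow> real) set" where
  "Cc = {f. continuous_on UNIV f \<and> compact (closure {x. f x \<noteq> 0})}"

section \<open>Metric measure spaces\<close>

definition radon_measure :: "'a::topological_space measure \<Rightarrow> bool" where
  "radon_measure M \<longleftrightarrow>
     sets M = sets borel \<and>
     (\<forall>K. compact K \<longrightarrow> emeasure M K < \<infinity>) \<and>
     (\<forall>A\<in>sets M. emeasure M A = (INF U\<in>{U. open U \<and> A \<subseteq> U}. emeasure M U)) \<and>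
     (\<forall>U. open U \<longrightarrow> emeasure M U = (SUP K\<in>{K. compact K \<and> K \<subseteq> U}. emeasure M K))"

definition measure_support :: "'a::topological_space measure \<Rightarrow> 'a set" where
  "measure_support M = {x. \<forall>U. open U \<and> x \<in> U \<longrightarrow> emeasure M U > 0}"

definition ahlfors_regular :: "'a::metric_space measure \<Rightarrow> real \<Rightarrow> bool" where
  "ahlfors_regular M dH \<longleftrightarrow>
     dH > 0 \<and>
     (\<exists>c1>0. \<exists>c2>0. \<forall>x. \<forall>r\<ge>0.
        ennreal (c1 * r powr dH) \<le> emeasure M (ball x r) \<and>
        emeasure M (ball x r) \<le> ennreal (c2 * r powr dH))"

section \<open>Dirichlet forms\<close>

text \<open>The form \<open>E\<close> is only meaningful on the domain \<open>F\<close>, a set of representatives that is saturated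
  under almost everywhere equality.\<close>

definition form1 :: "'b measure \<Rightarrow> (('b \<Rightarrow> real) \<Rightarrow> ('b \<Rightarrow> real) \<Rightarrow> real) \<Rightarrow> ('b \<Rightarrow> real) \<Rightarrow> real" where
  "form1 M E u = E u u + L2_inner M u u"

definition dirichlet_form ::
  "'b measure \<Rightarrow> (('b \<Rightarrow> real) \<Rightarrow> ('b \<Rightarrow> real) \<Rightarrow> real) \<Rightarrow> ('b \<Rightarrow> real) set \<Rightarrow> bool" where
  "dirichlet_form M E F \<longleftrightarrow>
     \<comment> \<open>\<open>F\<close> is a dense linear subspace of \<open>L2\<close>\<close>
     F \<subseteq> L2 M \<and>
     (\<forall>u\<in>F. \<forall>v\<in>borel_measurable M. (AE x in M. u x = v x) \<longrightarrow> v \<in> F \<and> (\<forall>w\<in>F. E u w = E v w)) \<and>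
     (\<forall>u\<in>F. \<forall>v\<in>F. \<forall>a b. (\<lambda>x. a * u x + b * v x) \<in> F) \<and>
     (\<forall>f\<in>L2 M. \<forall>\<epsilon>>0. \<exists>u\<in>F. L2_norm M (\<lambda>x. f x - u x) < \<epsilon>) \<and>
     \<comment> \<open>\<open>E\<close> is a nonnegative symmetric bilinear form\<close>
     (\<forall>u\<in>F. \<forall>v\<in>F. \<forall>w\<in>F. \<forall>a b. E (\<lambda>x. a * u x + b * v x) w = a * E u w + b * E v w) \<and>
     (\<forall>u\<in>F. \<forall>v\<in>F. E u v = E v u) \<and>
     (\<forall>u\<in>F. E u u \<ge> 0) \<and>
     \<comment> \<open>closedness\<close>
     (\<forall>u :: nat \<Rightarrow> 'b \<Rightarrow> real.
        (\<forall>n. u n \<in> F) \<and>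
        (\<forall>\<epsilon>>0. \<exists>N. \<forall>m\<ge>N. \<forall>n\<ge>N. form1 M E (\<lambda>x. u m x - u n x) < \<epsilon>) \<longrightarrow>
        (\<exists>v\<in>F. (\<lambda>n. form1 M E (\<lambda>x. u n x - v x)) \<longlonglongrightarrow> 0)) \<and>
     \<comment> \<open>Markov property: the unit contraction operates\<close>
     (\<forall>u\<in>F. (\<lambda>x. min (max (u x) 0) 1) \<in> F \<and>
        E (\<lambda>x. min (max (u x) 0) 1) (\<lambda>x. min (max (u x) 0) 1) \<le> E u u)"

definition regular_form ::
  "'a::metric_space measure \<Rightarrow> (('a \<Rightarrow> real) \<Rightarrow> ('a \<Rightarrow> real) \<Rightarrow> real) \<Rightarrow> ('a \<Rightarrow> real) set \<Rightarrow> bool" where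
  "regular_form M E F \<longleftrightarrow>
     (\<forall>u\<in>F. \<forall>\<epsilon>>0. \<exists>v\<in>F \<inter> Cc. form1 M E (\<lambda>x. u x - v x) < \<epsilon>) \<and>
     (\<forall>f\<in>Cc. \<forall>\<epsilon>>0. \<exists>v\<in>F \<inter> Cc. \<forall>x. \<bar>f x - v x\<bar> < \<epsilon>)"

text \<open>The support of a class of functions: the complement of the largest open set on which the
  function vanishes almost everywhere.\<close>

definition fun_support :: "'a::topological_space measure \<Rightarrow> ('a \<Rightarrow> real) \<Rightarrow> 'a set" where
  "fun_support M u = {x. \<forall>U. open U \<and> x \<in> U \<longrightarrow> \<not> (AE y in M. y \<in> U \<longrightarrow> u y = 0)}"

definition strongly_local ::
  "'a::metric_space measure \<Rightarrow> (('a \<Rightarrow> real) \<Rightarrow> ('a \<Rightarrow> real) \<Rightarrow> real) \<Rightarrow> ('a \<Rightarrow> real) set \<Rightarrow> bool" where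
  "strongly_local M E F \<longleftrightarrow>
     (\<forall>u\<in>F. \<forall>v\<in>F.
        compact (fun_support M u) \<and> compact (fun_support M v) \<and>
        (\<exists>U c. open U \<and> fun_support M v \<subseteq> U \<and> (AE x in M. x \<in> U \<longrightarrow> u x = c)) \<longrightarrow>
        E u v = 0)"

section \<open>Heat semigroup and heat kernel\<close>

text \<open>The heat semigroup of \<open>(E, F)\<close> is the strongly continuous contraction semigroup on \<open>L2\<close> whose
  infinitesimal generator is the operator of the form: \<open>u\<close> is in its domain with value \<open>h\<close> iff
  \<open>u \<in> F\<close> and \<open>E u v = - \<langle>h, v\<rangle>\<close> for all \<open>v \<in> F\<close>.\<close>

definition heat_semigroup ::
  "'b measure \<Rightarrow> (('b \<Rightarrow> real) \<Rightarrow> ('b \<Rightarrow> real) \<Rightarrow> real) \<Rightarrow> ('b \<Rightarrow> real) set \<Rightarrow>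
   (real \<Rightarrow> ('b \<Rightarrow> real) \<Rightarrow> 'b \<Rightarrow> real) \<Rightarrow> bool" where
  "heat_semigroup M E F P \<longleftrightarrow>
     (\<forall>t\<ge>0. \<forall>f\<in>L2 M. P t f \<in> L2 M \<and> L2_norm M (P t f) \<le> L2_norm M f) \<and>
     (\<forall>t\<ge>0. \<forall>f\<in>L2 M. \<forall>g\<in>L2 M. \<forall>a b.
        AE x in M. P t (\<lambda>z. a * f z + b * g z) x = a * P t f x + b * P t g x) \<and>
     (\<forall>f\<in>L2 M. AE x in M. P 0 f x = f x) \<and>
     (\<forall>s\<ge>0. \<forall>t\<ge>0. \<forall>f\<in>L2 M. AE x in M. P (s + t) f x = P s (P t f) x) \<and>
     (\<forall>f\<in>L2 M. ((\<lambda>t. L2_norm M (\<lambda>x. P t f x - f x)) \<longlongrightarrow> 0) (at_right 0)) \<and>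
     (\<forall>u\<in>L2 M. \<forall>h\<in>L2 M.
        ((\<lambda>t. L2_norm M (\<lambda>x. (P t u x - u x) / t - h x)) \<longlongrightarrow> 0) (at_right 0) \<longleftrightarrow>
        u \<in> F \<and> (\<forall>v\<in>F. E u v = - L2_inner M h v))"

definition kernel_op ::
  "'b measure \<Rightarrow> (real \<Rightarrow> 'b \<Rightarrow> 'b \<Rightarrow> real) \<Rightarrow> real \<Rightarrow> ('b \<Rightarrow> real) \<Rightarrow> 'b \<Rightarrow> real" where
  "kernel_op M p t g x = (\<integral>y. p t x y * g y \<partial>M)"

text \<open>Integrability is demanded explicitly because the Bochner integral of a non-integrable function
  is zero by convention.\<close>

definition heat_kernel ::
  "'b measure \<Rightarrow> (('b \<Rightarrow> real) \<Rightarrow> ('b \<Rightarrow> real) \<Rightarrow> real) \<Rightarrow> ('b \<Rightarrow> real) set \<Rightarrow>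
   (real \<Rightarrow> 'b \<Rightarrow> 'b \<Rightarrow> real) \<Rightarrow> bool" where
  "heat_kernel M E F p \<longleftrightarrow>
     (\<exists>P. heat_semigroup M E F P \<and>
        (\<forall>t>0. \<forall>g\<in>L2 M. AE x in M.
           integrable M (\<lambda>y. p t x y * g y) \<and> P t g x = kernel_op M p t g x))"

definition sub_gaussian_bounds ::
  "'a::metric_space measure \<Rightarrow> (real \<Rightarrow> 'a \<Rightarrow> 'a \<Rightarrow> real) \<Rightarrow> real \<Rightarrow> real \<Rightarrow> bool" where
  "sub_gaussian_bounds M p dH dW \<longleftrightarrow>
     (\<exists>c3>0. \<exists>c4>0. \<exists>c5>0. \<exists>c6>0. \<forall>t>0. AE (x, y) in M \<Otimes>\<^sub>M M.
        c5 * t powr (- dH / dW) * exp (- c6 * (dist x y powr dW / t) powr (1 / (dW - 1))) \<le> p t x y \<and>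
        p t x y \<le> c3 * t powr (- dH / dW) * exp (- c4 * (dist x y powr dW / t) powr (1 / (dW - 1))))"

text \<open>The underlying set \<open>X\<close> is the whole type; \<open>M\<close> is the measure and \<open>p\<close> the continuous version of
  the heat kernel.\<close>

definition sub_gaussian_dirichlet_space ::
  "'a::metric_space measure \<Rightarrow> (('a \<Rightarrow> real) \<Rightarrow> ('a \<Rightarrow> real) \<Rightarrow> real) \<Rightarrow> ('a \<Rightarrow> real) set \<Rightarrow>
   (real \<Rightarrow> 'a \<Rightarrow> 'a \<Rightarrow> real) \<Rightarrow> real \<Rightarrow> real \<Rightarrow> bool" where
  "sub_gaussian_dirichlet_space M E F p dH dW \<longleftrightarrow>
     locally compact (UNIV :: 'a set) \<and>
     radon_measure M \<and> measure_support M = UNIV \<and>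
     dirichlet_form M E F \<and>
     (\<forall>x::'a. \<forall>r>0. compact (closure (ball x r))) \<and>
     ahlfors_regular M dH \<and>
     regular_form M E F \<and> strongly_local M E F \<and>
     heat_kernel M E F p \<and>
     (\<forall>t>0. continuous_on UNIV (\<lambda>(x, y). p t x y)) \<and>
     dW > 2 \<and> sub_gaussian_bounds M p dH dW"

section \<open>The weak Bakry-Emery condition and product spaces\<close>

text \<open>The metric is an explicit argument so that the same definition applies to a space and to its
  powers; the underlying set is the space of the measure.\<close>

definition wBE ::
  "'b measure \<Rightarrow> ('b \<Rightarrow> 'b \<Rightarrow> real) \<Rightarrow> (real \<Rightarrow> 'b \<Rightarrow> 'b \<Rightarrow> real) \<Rightarrow> real \<Rightarrow> real \<Rightarrow> bool" where
  "wBE M d p dW \<kappa> \<longleftrightarrow>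
     (\<exists>C>0. \<forall>t>0. \<forall>g\<in>Linf M. \<forall>x\<in>space M. \<forall>y\<in>space M.
        \<bar>kernel_op M p t g x - kernel_op M p t g y\<bar>
          \<le> C * (d x y powr \<kappa> / t powr (\<kappa> / dW)) * Linf_norm M g)"

text \<open>Points of the \<open>n\<close>-th power are the functions \<open>nat \<Rightarrow> 'a\<close> that are extensional on \<open>{..<n}\<close>.\<close>

definition power_measure :: "nat \<Rightarrow> 'a measure \<Rightarrow> (nat \<Rightarrow> 'a) measure" where
  "power_measure n M = Pi\<^sub>M {..<n} (\<lambda>_. M)"

definition power_dist :: "nat \<Rightarrow> real \<Rightarrow> (nat \<Rightarrow> 'a::metric_space) \<Rightarrow> (nat \<Rightarrow> 'a) \<Rightarrow> real" where
  "power_dist n dW x y = (\<Sum>i<n. dist (x i) (y i) powr (dW / (dW - 1))) powr ((dW - 1) / dW)"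

lemma power_dist_powr:
  assumes "dW > 1"
  shows "power_dist n dW x y powr (dW / (dW - 1)) = (\<Sum>i<n. dist (x i) (y i) powr (dW / (dW - 1)))"
  using assms by (simp add: power_dist_def powr_powr sum_nonneg)

definition power_kernel ::
  "nat \<Rightarrow> (real \<Rightarrow> 'a \<Rightarrow> 'a \<Rightarrow> real) \<Rightarrow> real \<Rightarrow> (nat \<Rightarrow> 'a) \<Rightarrow> (nat \<Rightarrow> 'a) \<Rightarrow> real" where
  "power_kernel n p t x y = (\<Prod>i<n. p t (x i) (y i))"

end

theory Submission
  imports Defs
begin

text \<open>By duality, the weak Bakry-Emery condition is an \<open>L\<^sup>1\<close> bound on differences of the heat kernel.
  The difference of two product kernels telescopes into products in which one factor is such a
  difference and the others are kernels, and Fubini's theorem evaluates each of these products. The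
  kernels are bounded in \<open>L\<^sup>1\<close> uniformly in time and space, by the sub-Gaussian upper bound (which
  holds everywhere, since the kernel is continuous and the measure has full support) and Ahlfors
  regularity.\<close>

section \<open>Telescoping of finite products\<close>

text \<open>Swapping factors one at a time leaves factors \<open>a\<close> on one side of the
  swapped index and \<open>b\<close> on the other. Majorizing both by
  \<open>\<bar>a i\<bar> + \<bar>b i\<bar>\<close> removes the dependence on an ordering of
  \<open>I\<close>. When the factors depend on separate coordinates, each summand stays a product to
  which Fubini applies.\<close>

lemma abs_diff_prod_le_sum_prod:
  fixes a b :: "'i \<Rightarrow> real"
  assumes "finite I"
  shows "\<bar>prod a I - prod b I\<bar>
    \<le> (\<Sum>k\<in>I. \<Prod>i\<in>I. if i = k then \<bar>a i - b i\<bar> else \<bar>a i\<bar> + \<bar>b i\<bar>)"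
  using assms
proof (induction I)
  case empty
  then show ?case by simp
next
  case (insert j I)
  let ?h = "\<lambda>k i. if i = k then \<bar>a i - b i\<bar> else \<bar>a i\<bar> + \<bar>b i\<bar>"
  have "prod a (insert j I) - prod b (insert j I)
      = (a j - b j) * prod a I + b j * (prod a I - prod b I)"
    using insert by (simp add: algebra_simps)
  also have "\<bar>\<dots>\<bar> \<le> \<bar>a j - b j\<bar> * \<bar>prod a I\<bar> + \<bar>b j\<bar> * \<bar>prod a I - prod b I\<bar>"
    by (metis abs_mult abs_triangle_ineq)
  also have "\<dots> \<le> \<bar>a j - b j\<bar> * (\<Prod>i\<in>I. \<bar>a i\<bar> + \<bar>b i\<bar>)
      + (\<bar>a j\<bar> + \<bar>b j\<bar>) * (\<Sum>k\<in>I. \<Prod>i\<in>I. ?h k i)"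
    using insert.IH by (intro add_mono mult_mono) (auto simp: abs_prod intro!: prod_mono prod_nonneg sum_nonneg)
  also have "\<bar>a j - b j\<bar> * (\<Prod>i\<in>I. \<bar>a i\<bar> + \<bar>b i\<bar>) = (\<Prod>i\<in>insert j I. ?h j i)"
    using insert.hyps by (auto simp: intro!: prod.cong)
  also have "(\<bar>a j\<bar> + \<bar>b j\<bar>) * (\<Sum>k\<in>I. \<Prod>i\<in>I. ?h k i) = (\<Sum>k\<in>I. \<Prod>i\<in>insert j I. ?h k i)"
    using insert.hyps by (auto simp: sum_distrib_left intro!: sum.cong)
  finally show ?case
    using insert.hyps by simp
qed

section \<open>The essential supremum norm and its duality with \<open>L1\<close>\<close>

text \<open>If the total mass is zero, the essential supremum is \<open>-\<infinity>\<close>, which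
  \<open>real_of_ereal\<close> sends to 0; otherwise it dominates that of the constant 0.\<close>

lemma Linf_norm_nonneg:
  assumes "f \<in> borel_measurable M"
  shows "Linf_norm M f \<ge> 0"
proof (cases "emeasure M (space M) = 0")
  case True
  then show ?thesis
    using assms by (simp add: Linf_norm_def esssup_zero_space)
next
  case False
  have "esssup M (\<lambda>_. 0 :: ereal) \<le> esssup M (\<lambda>x. ereal \<bar>f x\<bar>)"
    using assms by (intro esssup_mono) (auto simp flip: zero_ereal_def)
  then show ?thesis
    using False by (simp add: Linf_norm_def esssup_const real_of_ereal_pos)
qed

text \<open>The conversion to a real loses nothing: membership in \<open>Linf M\<close> excludes
  \<open>\<infinity>\<close>, and \<open>-\<infinity>\<close> cannot bound
  \<open>\<bar>f x\<bar>\<close>.\<close>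

lemma AE_abs_le_Linf_norm:
  assumes "f \<in> Linf M"
  shows "AE x in M. \<bar>f x\<bar> \<le> Linf_norm M f"
  using esssup_AE[of "\<lambda>x. ereal \<bar>f x\<bar>" M]
proof (eventually_elim)
  case (elim x)
  then show ?case
    using assms unfolding Linf_def Linf_norm_def
    by (cases "esssup M (\<lambda>x. ereal \<bar>f x\<bar>)") auto
qed

lemma bounded_imp_Linf:
  assumes f: "f \<in> borel_measurable M" and le: "\<And>x. \<bar>f x\<bar> \<le> c"
  shows "f \<in> Linf M \<and> Linf_norm M f \<le> c"
proof
  have *: "esssup M (\<lambda>x. ereal \<bar>f x\<bar>) \<le> ereal c"
    using f le by (intro esssup_I) auto
  then show "f \<in> Linf M"
    using f by (auto simp: Linf_def intro: le_less_trans)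
  \<comment> \<open>This settles the case of essential supremum \<open>-\<infinity>\<close>, where
    the norm takes the default value 0.\<close>
  have "0 \<le> c" using le[of undefined] by linarith
  then show "Linf_norm M f \<le> c"
    using * unfolding Linf_norm_def
    by (cases "esssup M (\<lambda>x. ereal \<bar>f x\<bar>)") auto
qed

text \<open>The extremal test function is the sign of the difference of the kernels.\<close>

lemma wBE_imp_L1_bound:
  assumes "wBE M d p dW \<kappa>"
    and int: "\<And>t x. t > 0 \<Longrightarrow> x \<in> space M \<Longrightarrow> integrable M (p t x)"
  obtains C where "C > 0"
    and "\<And>t x y. t > 0 \<Longrightarrow> x \<in> space M \<Longrightarrow> y \<in> space M \<Longrightarrow>
      (\<integral>z. \<bar>p t x z - p t y z\<bar> \<partial>M) \<le> C * (d x y powr \<kappa> / t powr (\<kappa> / dW))"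
proof -
  obtain C where C: "C > 0" "\<And>t g x y. t > 0 \<Longrightarrow> g \<in> Linf M \<Longrightarrow> x \<in> space M \<Longrightarrow> y \<in> space M \<Longrightarrow>
      \<bar>kernel_op M p t g x - kernel_op M p t g y\<bar>
        \<le> C * (d x y powr \<kappa> / t powr (\<kappa> / dW)) * Linf_norm M g"
    using assms(1) unfolding wBE_def by blast
  have "(\<integral>z. \<bar>p t x z - p t y z\<bar> \<partial>M) \<le> C * (d x y powr \<kappa> / t powr (\<kappa> / dW))"
    if t: "t > 0" and xy: "x \<in> space M" "y \<in> space M" for t x y
  proof -
    note [measurable] = borel_measurable_integrable[OF int[OF t xy(1)]]
      borel_measurable_integrable[OF int[OF t xy(2)]]
    define g where "g = (\<lambda>z. sgn (p t x z - p t y z))"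
    have g[measurable]: "g \<in> borel_measurable M"
      unfolding g_def by measurable
    have g1: "\<bar>g z\<bar> \<le> 1" for z
      by (simp add: g_def sgn_if)
    \<comment> \<open>Both products must be integrable before the integral of their difference can
      be split into two values of \<open>kernel_op\<close>.\<close>
    have int_g: "integrable M (\<lambda>z. p t w z * g z)" if "w \<in> {x, y}" for w
      using that
      by (intro Bochner_Integration.integrable_bound[OF int[OF t, of w]])
         (use xy g1 in \<open>auto simp: abs_mult intro!: mult_left_le\<close>)
    have "(\<integral>z. \<bar>p t x z - p t y z\<bar> \<partial>M) = (\<integral>z. p t x z * g z - p t y z * g z \<partial>M)"
      by (intro Bochner_Integration.integral_cong) (auto simp: g_def sgn_if)
    also have "\<dots> = kernel_op M p t g x - kernel_op M p t g y"
      using int_g by (simp add: kernel_op_def)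
    also have "\<dots> \<le> C * (d x y powr \<kappa> / t powr (\<kappa> / dW)) * Linf_norm M g"
      using C(2)[OF t conjunct1[OF bounded_imp_Linf[OF g g1]] xy] by linarith
    also have "\<dots> \<le> C * (d x y powr \<kappa> / t powr (\<kappa> / dW)) * 1"
      using C(1) by (intro mult_left_mono conjunct2[OF bounded_imp_Linf[OF g g1]]) auto
    finally show ?thesis by simp
  qed
  with C(1) show ?thesis by (rule that)
qed

section \<open>Passage to the product space\<close>

text \<open>\<open>power_dist\<close> is the \<open>l^\<beta>\<close> norm, with
  \<open>\<beta> = dW / (dW - 1)\<close>, of the vector of coordinate distances, so it dominates
  every entry.\<close>

lemma dist_le_power_dist:
  assumes "dW > 1" "i < n"
  shows "dist (x i) (y i) \<le> power_dist n dW x y"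
proof -
  let ?\<beta> = "dW / (dW - 1)"
  have "dist (x i) (y i) = (dist (x i) (y i) powr ?\<beta>) powr ((dW - 1) / dW)"
    using assms by (simp add: powr_powr)
  also have "\<dots> \<le> power_dist n dW x y"
    unfolding power_dist_def using assms
    by (intro powr_mono2 member_le_sum) auto
  finally show ?thesis .
qed

text \<open>Tensorization, detached from Dirichlet forms: the kernel enters through its uniform
  \<open>L1\<close> bound \<open>A\<close> and the \<open>L1\<close> bound on its
  differences.\<close>

lemma wBE_power:
  fixes M :: "'a::metric_space measure" and p :: "real \<Rightarrow> 'a \<Rightarrow> 'a \<Rightarrow> real"
  assumes sf: "sigma_finite_measure M" and space: "space M = UNIV"
    and int: "\<And>t x. t > 0 \<Longrightarrow> integrable M (p t x)"
    and L1: "\<And>t x. t > 0 \<Longrightarrow> (\<integral>y. \<bar>p t x y\<bar> \<partial>M) \<le> A" and A: "A > 0"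
    and dW: "dW > 1" and "\<kappa> > 0" and "n \<ge> 1"
    and wBE: "wBE M dist p dW \<kappa>"
  shows "wBE (power_measure n M) (power_dist n dW) (power_kernel n p) dW \<kappa>"
proof -
  have psf: "product_sigma_finite (\<lambda>_::nat. M)"
    using sf by (simp add: product_sigma_finite_def)
  obtain C where C: "C > 0" and L1d: "\<And>t x y. t > 0 \<Longrightarrow>
      (\<integral>z. \<bar>p t x z - p t y z\<bar> \<partial>M) \<le> C * (dist x y powr \<kappa> / t powr (\<kappa> / dW))"
    by (rule wBE_imp_L1_bound[OF wBE int]) (simp_all add: space)
  let ?N = "power_measure n M"
  \<comment> \<open>There are \<open>n\<close> positions for the difference factor; it contributes
    \<open>C\<close>, and each of the other \<open>n - 1\<close> factors contributes
    \<open>2 * A\<close>.\<close>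
  define D where "D = real n * C * (2 * A) ^ (n - 1)"
  have "D > 0"
    using C A \<open>n \<ge> 1\<close> by (simp add: D_def)
  moreover have "\<bar>kernel_op ?N (power_kernel n p) t f x - kernel_op ?N (power_kernel n p) t f y\<bar>
      \<le> D * (power_dist n dW x y powr \<kappa> / t powr (\<kappa> / dW)) * Linf_norm ?N f"
    if t: "t > 0" and f: "f \<in> Linf ?N" for t f x y
  proof -
    let ?K = "power_kernel n p t" and ?L = "Linf_norm ?N f"
    let ?\<delta> = "power_dist n dW x y powr \<kappa> / t powr (\<kappa> / dW)"
    \<comment> \<open>\<open>h k i\<close> is the \<open>i\<close>-th factor of the
      \<open>k\<close>-th telescoping term, as a function of the coordinate \<open>z\<close>
      alone.\<close>
    define h where "h = (\<lambda>k i z. if i = k then \<bar>p t (x i) z - p t (y i) z\<bar>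
      else \<bar>p t (x i) z\<bar> + \<bar>p t (y i) z\<bar>)"
    have int_h: "integrable M (h k i)" for k i
      using int[OF t] by (cases "i = k") (auto simp: h_def)
    have h_le: "(\<integral>z. h k i z \<partial>M) \<le> (if i = k then C * ?\<delta> else 2 * A)" if "i < n" for k i
    proof (cases "i = k")
      case True
      \<comment> \<open>Passing to the product distance here, by monotonicity of the power \<kappa>,
        makes the bound the same for every position \<open>k\<close>.\<close>
      have "dist (x i) (y i) powr \<kappa> \<le> power_dist n dW x y powr \<kappa>"
        using dW that \<open>\<kappa> > 0\<close> by (intro powr_mono2 dist_le_power_dist) auto
      then have "C * (dist (x i) (y i) powr \<kappa> / t powr (\<kappa> / dW)) \<le> C * ?\<delta>"
        using C by (intro mult_left_mono divide_right_mono) auto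
      then show ?thesis
        using True L1d[OF t, of "x i" "y i"] by (simp add: h_def)
    next
      case False
      then show ?thesis
        using int[OF t] L1[OF t, of "x i"] L1[OF t, of "y i"] by (simp add: h_def)
    qed
    have int_H: "integrable ?N (\<lambda>w. \<Prod>i<n. h k i (w i))" for k
      unfolding power_measure_def by (intro product_sigma_finite.product_integrable_prod[OF psf] int_h) auto
    have H_le: "(\<integral>w. (\<Prod>i<n. h k i (w i)) \<partial>?N) \<le> C * ?\<delta> * (2 * A) ^ (n - 1)" if "k < n" for k
    proof -
      \<comment> \<open>Fubini factors the integral; the factor bounds may then be multiplied
        because every \<open>h k i\<close> is nonnegative.\<close>
      have "(\<integral>w. (\<Prod>i<n. h k i (w i)) \<partial>?N) = (\<Prod>i<n. \<integral>z. h k i z \<partial>M)"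
        unfolding power_measure_def by (intro product_sigma_finite.product_integral_prod[OF psf] int_h) auto
      also have "\<dots> \<le> (\<Prod>i<n. if i = k then C * ?\<delta> else 2 * A)"
        using h_le by (intro prod_mono) (auto simp: h_def)
      also have "\<dots> = C * ?\<delta> * (2 * A) ^ (n - 1)"
        using that by (subst prod.remove[of _ k]) auto
      finally show ?thesis .
    qed
    have int_K: "integrable ?N (?K v)" for v
      unfolding power_measure_def power_kernel_def
      by (intro product_sigma_finite.product_integrable_prod[OF psf] int t) auto
    have [measurable]: "f \<in> borel_measurable ?N" "\<And>v. ?K v \<in> borel_measurable ?N"
      using f int_K by (auto simp: Linf_def)
    have L0: "?L \<ge> 0"
      by (intro Linf_norm_nonneg) simp
    have f_le: "AE w in ?N. \<bar>f w\<bar> \<le> ?L"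
      by (rule AE_abs_le_Linf_norm[OF f])
    \<comment> \<open>Hoelder's inequality with exponents 1 and \<infinity>: \<open>f\<close> is
      bounded only almost everywhere, so the domination is too.\<close>
    have int_Kf: "integrable ?N (\<lambda>w. ?K v w * f w)" for v
    proof (rule Bochner_Integration.integrable_bound)
      show "integrable ?N (\<lambda>w. ?K v w * ?L)"
        using int_K by simp
      show "AE w in ?N. norm (?K v w * f w) \<le> norm (?K v w * ?L)"
        using f_le by eventually_elim (use L0 in \<open>auto simp: abs_mult intro!: mult_left_mono\<close>)
    qed simp
    have "\<bar>kernel_op ?N (power_kernel n p) t f x - kernel_op ?N (power_kernel n p) t f y\<bar>
        = \<bar>\<integral>w. ?K x w * f w - ?K y w * f w \<partial>?N\<bar>"
      using int_Kf by (simp add: kernel_op_def)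
    also have "\<dots> \<le> (\<integral>w. \<bar>?K x w * f w - ?K y w * f w\<bar> \<partial>?N)"
      by (rule integral_abs_bound)
    also have "\<dots> \<le> (\<integral>w. (\<Sum>k<n. \<Prod>i<n. h k i (w i)) * ?L \<partial>?N)"
    proof (rule integral_mono_AE)
      show "integrable ?N (\<lambda>w. \<bar>?K x w * f w - ?K y w * f w\<bar>)"
        using int_Kf by simp
      show "integrable ?N (\<lambda>w. (\<Sum>k<n. \<Prod>i<n. h k i (w i)) * ?L)"
        using int_H by simp
      show "AE w in ?N. \<bar>?K x w * f w - ?K y w * f w\<bar> \<le> (\<Sum>k<n. \<Prod>i<n. h k i (w i)) * ?L"
        using f_le
      proof eventually_elim
        case (elim w)
        have "\<bar>?K x w - ?K y w\<bar> \<le> (\<Sum>k<n. \<Prod>i<n. h k i (w i))"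
          unfolding power_kernel_def h_def by (rule abs_diff_prod_le_sum_prod) simp
        then have "\<bar>?K x w - ?K y w\<bar> * \<bar>f w\<bar> \<le> (\<Sum>k<n. \<Prod>i<n. h k i (w i)) * ?L"
          using elim by (intro mult_mono) auto
        then show ?case
          by (simp add: left_diff_distrib flip: abs_mult)
      qed
    qed
    also have "\<dots> = (\<Sum>k<n. \<integral>w. (\<Prod>i<n. h k i (w i)) \<partial>?N) * ?L"
      using int_H by simp
    also have "\<dots> \<le> (\<Sum>k<n. C * ?\<delta> * (2 * A) ^ (n - 1)) * ?L"
      using H_le L0 by (intro mult_right_mono sum_mono) auto
    also have "\<dots> = D * ?\<delta> * ?L"
      by (simp add: D_def)
    finally show ?thesis .
  qed
  ultimately show ?thesis
    unfolding wBE_def by blast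
qed

section \<open>Full support and sigma-finiteness\<close>

text \<open>A nonempty open exceptional set would contain an open rectangle, which has positive
  measure by full support. Working with a rectangle also settles measurability: an open subset of
  the product need not lie in the product sigma-algebra.\<close>

lemma open_imp_AE_pair_imp_all:
  fixes M :: "'a::topological_space measure"
  assumes sf: "sigma_finite_measure M" and sets: "sets M = sets borel"
    and supp: "measure_support M = UNIV"
    and ae: "AE z in M \<Otimes>\<^sub>M M. P z"
    and op: "open {z. \<not> P z}"
  shows "P z"
proof (rule ccontr)
  assume "\<not> P z"
  then obtain U V where UV: "open U" "open V" "z \<in> U \<times> V" "U \<times> V \<subseteq> {z. \<not> P z}"
    using op unfolding open_prod_def by (metis mem_Collect_eq)
  have UVm: "U \<in> sets M" "V \<in> sets M"
    using UV sets by auto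
  then have "U \<times> V \<in> sets (M \<Otimes>\<^sub>M M)" by simp
  moreover have "AE w in M \<Otimes>\<^sub>M M. w \<notin> U \<times> V"
    using ae by eventually_elim (use UV in auto)
  ultimately have "emeasure (M \<Otimes>\<^sub>M M) (U \<times> V) = 0"
    by (subst (asm) AE_iff_measurable[where N="U \<times> V"])
       (use sets_eq_imp_space_eq[OF sets] in \<open>auto simp: space_pair_measure\<close>)
  then have "emeasure M U * emeasure M V = 0"
    using UVm by (simp add: sigma_finite_measure.emeasure_pair_measure_Times[OF sf])
  moreover have "emeasure M U > 0" "emeasure M V > 0"
    using supp UV unfolding measure_support_def by (auto simp: mem_Times_iff set_eq_iff)
  ultimately show False by auto
qed

text \<open>Balls of integer radius about one arbitrary point exhaust the space, and the upper
  volume bound makes them finite.\<close>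

lemma ahlfors_regular_sigma_finite:
  fixes M :: "'a::metric_space measure"
  assumes sets: "sets M = sets borel" and "ahlfors_regular M dH"
  shows "sigma_finite_measure M"
proof
  obtain c2 where c2: "\<And>x r. r \<ge> 0 \<Longrightarrow> emeasure M (ball x r) \<le> ennreal (c2 * r powr dH)"
    using assms(2) unfolding ahlfors_regular_def by blast
  let ?A = "range (\<lambda>n::nat. ball (undefined::'a) (real n))"
  have "countable ?A" by simp
  moreover have "?A \<subseteq> sets M" unfolding sets by (intro image_subsetI borel_open open_ball)
  moreover have "\<Union> ?A = space M"
  proof -
    have "x \<in> \<Union> ?A" for x
      using reals_Archimedean2[of "dist undefined x"] by (simp only: Union_iff bex_simps mem_ball)
    moreover have "space M = UNIV"
      using sets_eq_imp_space_eq[OF sets] by simp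
    ultimately show ?thesis by (simp only: set_eq_iff UNIV_I simp_thms)
  qed
  moreover have "emeasure M (ball undefined (real n)) \<noteq> \<infinity>" for n
    using le_less_trans[OF c2[OF of_nat_0_le_iff] ennreal_less_top] by (metis infinity_ennreal_def less_irrefl)
  then have "\<forall>a\<in>?A. emeasure M a \<noteq> \<infinity>"
    by blast
  ultimately show "\<exists>A. countable A \<and> A \<subseteq> sets M \<and> \<Union> A = space M \<and> (\<forall>a\<in>A. emeasure M a \<noteq> \<infinity>)"
    by blast
qed

section \<open>Uniform \<open>L1\<close> bound of the heat kernel\<close>

text \<open>Half of the exponential decay absorbs the power, and the other half leaves a geometric
  series. This is the series that arises from summing over annuli.\<close>

lemma summable_powr_times_exp:
  fixes a c :: real
  assumes "a > 0" "c > 0"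
  shows "summable (\<lambda>k. (real k + 1) powr a * exp (- c * real k))"
proof (rule summable_comparison_test')
  \<comment> \<open>Chosen so that \<open>a * \<delta> = c / 2\<close>: the linear bound on
    \<open>a * ln (real k + 1)\<close> then costs exactly half the decay rate, and \<open>B\<close>
    collects the constant terms.\<close>
  define \<delta> where "\<delta> = c / (2 * a)"
  define B where "B = exp (c / 2 - a * ln \<delta>)"
  show "summable (\<lambda>k. B * exp (- c / 2) ^ k)"
    using assms by (intro summable_mult summable_geometric) simp
  show "norm ((real k + 1) powr a * exp (- c * real k)) \<le> B * exp (- c / 2) ^ k" if "k \<ge> 0" for k
  proof -
    have \<delta>: "\<delta> > 0" "a * \<delta> = c / 2"
      using assms by (auto simp: \<delta>_def)
    have "ln (real k + 1) = ln (\<delta> * (real k + 1)) - ln \<delta>"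
      using \<delta> by (simp add: ln_mult)
    also have "\<dots> \<le> \<delta> * (real k + 1) - ln \<delta>"
      using \<delta> ln_le_minus_one[of "\<delta> * (real k + 1)"] by simp
    finally have "a * ln (real k + 1) \<le> a * (\<delta> * (real k + 1) - ln \<delta>)"
      using assms by (intro mult_left_mono) auto
    also have "\<dots> = c / 2 * (real k + 1) - a * ln \<delta>"
      by (simp add: right_diff_distrib \<delta>(2) flip: mult.assoc)
    finally have "a * ln (real k + 1) - c * real k \<le> (c / 2 - a * ln \<delta>) - c / 2 * real k"
      by (simp add: algebra_simps)
    then have "exp (a * ln (real k + 1) - c * real k) \<le> B * exp (- c / 2) ^ k"
      by (simp add: B_def mult.commute flip: exp_of_nat_mult exp_add)
    then show ?thesis
      by (simp add: powr_def exp_diff exp_minus field_simps)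
  qed
qed

text \<open>Decompose the space into the annuli of inner radius \<open>k t\<^bsup>1/dW\<^esup>\<close> and width \<open>t\<^bsup>1/dW\<^esup>\<close>.\<close>

lemma nn_integral_sub_gaussian_bound:
  fixes M :: "'a::metric_space measure" and c4 :: real
  assumes sets: "sets M = sets borel" and "ahlfors_regular M dH"
    and c4: "c4 > 0" and dW: "dW > 1"
  obtains A where "A > 0"
    and "\<And>t x. t > 0 \<Longrightarrow> (\<integral>\<^sup>+ y. ennreal (t powr (- dH / dW) *
      exp (- c4 * (dist x y powr dW / t) powr (1 / (dW - 1)))) \<partial>M) \<le> ennreal A"
proof -
  obtain c2 where dH: "dH > 0" and c2: "c2 > 0"
    "\<And>x r. r \<ge> 0 \<Longrightarrow> emeasure M (ball x r) \<le> ennreal (c2 * r powr dH)"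
    using assms(2) unfolding ahlfors_regular_def by blast
  define s where "s = (\<lambda>k. (real k + 1) powr dH * exp (- c4 * real k))"
  have s: "summable s"
    unfolding s_def by (intro summable_powr_times_exp dH c4)
  have s0: "s k > 0" for k
    by (simp add: s_def)
  \<comment> \<open>\<open>c2\<close> comes from the ball volumes and \<open>exp c4\<close> from the
    loss of one unit in the lower bound for the exponent.\<close>
  define A where "A = exp c4 * c2 * suminf s"
  have "A > 0"
    using c2 s s0 by (simp add: A_def suminf_pos)
  moreover have "(\<integral>\<^sup>+ y. ennreal (t powr (- dH / dW) *
      exp (- c4 * (dist x y powr dW / t) powr (1 / (dW - 1)))) \<partial>M) \<le> ennreal A"
    if t: "t > 0" for t x
  proof -
    \<comment> \<open>The length scale of diffusion at time \<open>t\<close>: a ball of radius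
      \<open>r\<close> has volume of order \<open>t powr (dH / dW)\<close>, which the prefactor of
      the kernel compensates.\<close>
    define r where "r = t powr (1 / dW)"
    have r: "r > 0" using t by (simp add: r_def)
    have r_dW: "r powr dW = t" and r_dH: "r powr dH = t powr (dH / dW)"
      using t dW by (auto simp: r_def powr_powr)
    define c where "c = (\<lambda>k. t powr (- dH / dW) * exp c4 * exp (- c4 * real k))"
    have "ennreal (t powr (- dH / dW) * exp (- c4 * (dist x y powr dW / t) powr (1 / (dW - 1))))
        \<le> (\<Sum>k. ennreal (c k) * indicator (ball x ((real k + 1) * r)) y)" for y
    proof -
      define u where "u = dist x y / r"
      have u0: "u \<ge> 0" using r by (simp add: u_def)
      have "(dist x y powr dW / t) powr (1 / (dW - 1)) = (u powr dW) powr (1 / (dW - 1))"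
        using r by (simp add: u_def powr_divide r_dW)
      also have "\<dots> = u powr (dW / (dW - 1))"
        by (simp add: powr_powr)
      \<comment> \<open>Since \<open>dW / (dW - 1) > 1\<close>, the power is at least
        \<open>u\<close> once \<open>u \<ge> 1\<close>; below that \<open>u - 1\<close> is negative.
        A linear bound is enough for summability.\<close>
      also have "\<dots> \<ge> u - 1"
      proof (cases "u \<ge> 1")
        case True
        then have "u powr 1 \<le> u powr (dW / (dW - 1))"
          using dW by (intro powr_mono) auto
        then show ?thesis using True by simp
      next
        case False
        then show ?thesis
          using powr_ge_zero[of u "dW / (dW - 1)"] by linarith
      qed
      finally have u1: "(dist x y powr dW / t) powr (1 / (dW - 1)) \<ge> u - 1" .
      \<comment> \<open>\<open>k\<close> is the index of the annulus containing \<open>y\<close>;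
        its term alone already dominates the integrand.\<close>
      define k where "k = nat \<lfloor>u\<rfloor>"
      have k: "real k \<le> u" "u < real k + 1"
        using u0 by (auto simp: k_def)
      have "- c4 * (dist x y powr dW / t) powr (1 / (dW - 1)) \<le> - c4 * (real k - 1)"
        using u1 k c4 by (intro mult_left_mono_neg) auto
      then have "exp (- c4 * (dist x y powr dW / t) powr (1 / (dW - 1)))
          \<le> exp c4 * exp (- c4 * real k)"
        by (simp add: algebra_simps flip: exp_add)
      then have "ennreal (t powr (- dH / dW) * exp (- c4 * (dist x y powr dW / t) powr (1 / (dW - 1))))
          \<le> ennreal (c k)"
        unfolding c_def by (intro ennreal_leI) (simp add: mult.assoc mult_left_mono)
      also have "\<dots> = ennreal (c k) * indicator (ball x ((real k + 1) * r)) y"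
        using k r by (simp add: u_def field_simps)
      also have "\<dots> \<le> (\<Sum>k. ennreal (c k) * indicator (ball x ((real k + 1) * r)) y)"
        using sum_le_suminf[of "\<lambda>k. ennreal (c k) * indicator (ball x ((real k + 1) * r)) y" "{k}"]
        by (simp del: sum_mult_indicator)
      finally show ?thesis .
    qed
    then have "(\<integral>\<^sup>+ y. ennreal (t powr (- dH / dW) *
        exp (- c4 * (dist x y powr dW / t) powr (1 / (dW - 1)))) \<partial>M)
      \<le> (\<integral>\<^sup>+ y. (\<Sum>k. ennreal (c k) * indicator (ball x ((real k + 1) * r)) y) \<partial>M)"
      by (intro nn_integral_mono)
    also have "\<dots> = (\<Sum>k. ennreal (c k) * emeasure M (ball x ((real k + 1) * r)))"
    proof -
      have [measurable]: "ball x ((real k + 1) * r) \<in> sets M" for k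
        using sets by simp
      show ?thesis
        by (subst nn_integral_suminf) (measurable, simp add: nn_integral_cmult_indicator)
    qed
    also have "\<dots> \<le> (\<Sum>k. ennreal (exp c4 * c2 * s k))"
    proof (intro suminf_le)
      fix k
      have "ennreal (c k) * emeasure M (ball x ((real k + 1) * r))
          \<le> ennreal (c k) * ennreal (c2 * ((real k + 1) * r) powr dH)"
        using c2 r by (intro mult_left_mono) auto
      also have "\<dots> = ennreal (c k * (c2 * ((real k + 1) * r) powr dH))"
        using c2 by (simp add: c_def ennreal_mult)
      also have "((real k + 1) * r) powr dH = (real k + 1) powr dH * t powr (dH / dW)"
        using r by (simp add: powr_mult r_dH)
      \<comment> \<open>The powers of \<open>t\<close> cancel, which makes the final bound uniform
        in time.\<close>
      also have "c k * (c2 * ((real k + 1) powr dH * t powr (dH / dW))) = exp c4 * c2 * s k"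
        using t by (simp add: c_def s_def powr_minus)
      finally show "ennreal (c k) * emeasure M (ball x ((real k + 1) * r))
        \<le> ennreal (exp c4 * c2 * s k)" .
    qed auto
    also have "\<dots> = ennreal A"
      using s s0 c2 unfolding A_def
      by (subst suminf_ennreal2) (auto simp: suminf_mult less_imp_le summable_mult)
    finally show ?thesis .
  qed
  ultimately show ?thesis by (rule that)
qed

text \<open>The bounds are needed at every \<open>x\<close>, since \<open>wBE\<close> quantifies
  over points; continuity of the kernel upgrades the almost everywhere estimate before it is
  integrated in \<open>y\<close>.\<close>

lemma sub_gaussian_kernel_L1_bound:
  fixes M :: "'a::metric_space measure"
  assumes "sub_gaussian_dirichlet_space M E F p dH dW" and sf: "sigma_finite_measure M"
  obtains A where "A > 0" and "\<And>t x. t > 0 \<Longrightarrow> integrable M (p t x)"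
    and "\<And>t x. t > 0 \<Longrightarrow> (\<integral>y. \<bar>p t x y\<bar> \<partial>M) \<le> A"
proof -
  have sets: "sets M = sets borel" and supp: "measure_support M = UNIV"
    and reg: "ahlfors_regular M dH" and dW: "dW > 2"
    and cont: "\<And>t. t > 0 \<Longrightarrow> continuous_on UNIV (\<lambda>(x, y). p t x y)"
    and sg: "sub_gaussian_bounds M p dH dW"
    using assms(1) unfolding sub_gaussian_dirichlet_space_def radon_measure_def by auto
  let ?G = "\<lambda>c t x y. t powr (- dH / dW) * exp (- c * (dist x y powr dW / t) powr (1 / (dW - 1)))"
  obtain c3 c4 c5 c6 where c: "c3 > 0" "c4 > 0" "c5 > 0" "c6 > 0"
    and ae: "\<And>t. t > 0 \<Longrightarrow> AE (x, y) in M \<Otimes>\<^sub>M M.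
      c5 * ?G c6 t x y \<le> p t x y \<and> p t x y \<le> c3 * ?G c4 t x y"
    using sg unfolding sub_gaussian_bounds_def by (simp only: mult.assoc) blast
  \<comment> \<open>On the diagonal the base of the powers vanishes; the exponents \<open>dW\<close>
    and \<open>1 / (dW - 1)\<close> are positive, so continuity persists there.\<close>
  have contG: "continuous_on UNIV (\<lambda>z :: 'a \<times> 'a. ?G c t (fst z) (snd z))" if "t > 0" for c t
    using that dW
    by (intro continuous_on_mult continuous_on_const continuous_on_exp continuous_on_powr'
        continuous_on_divide continuous_on_dist continuous_on_fst continuous_on_snd continuous_on_id)
       simp_all
  have bound: "\<bar>p t x y\<bar> \<le> c3 * ?G c4 t x y" if t: "t > 0" for t x y
  proof -
    let ?P = "\<lambda>z. \<bar>p t (fst z) (snd z)\<bar> \<le> c3 * ?G c4 t (fst z) (snd z)"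
    have "?P (x, y)"
    proof (rule open_imp_AE_pair_imp_all[where P = ?P and M = M])
      show "AE z in M \<Otimes>\<^sub>M M. ?P z"
        using ae[OF t]
      proof eventually_elim
        case (elim z)
        \<comment> \<open>The lower Gaussian bound supplies the sign of the kernel, so that the
          upper bound controls its absolute value.\<close>
        moreover have "c5 * ?G c6 t (fst z) (snd z) \<ge> 0"
          using c by simp
        ultimately show ?case
          by (auto simp: case_prod_beta)
      qed
      have "continuous_on UNIV (\<lambda>z. p t (fst z) (snd z))"
        using cont[OF t] by (simp add: case_prod_beta)
      moreover have "continuous_on UNIV (\<lambda>z :: 'a \<times> 'a. c3 * ?G c4 t (fst z) (snd z))"
        by (rule continuous_on_mult_left[OF contG[OF t]])
      \<comment> \<open>Failure of the bound is a strict inequality between continuous functions,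
        hence an open condition.\<close>
      ultimately show "open {z. \<not> ?P z}"
        unfolding not_le by (intro open_Collect_less continuous_on_rabs)
    qed (fact sf sets supp)+
    then show ?thesis by simp
  qed
  have meas: "p t x \<in> borel_measurable M" if t: "t > 0" for t x
  proof -
    have "continuous_on UNIV (\<lambda>y. (\<lambda>(x, y). p t x y) (x, y))"
      by (rule continuous_on_compose2[OF cont[OF t]]) (auto intro!: continuous_intros)
    then show ?thesis
      using sets by (simp add: borel_measurable_continuous_onI cong: measurable_cong_sets)
  qed
  obtain A where A: "A > 0" "\<And>t x. t > 0 \<Longrightarrow> (\<integral>\<^sup>+ y. ennreal (?G c4 t x y) \<partial>M) \<le> ennreal A"
    using nn_integral_sub_gaussian_bound[OF sets reg c(2), of dW] dW by auto
  have nn: "(\<integral>\<^sup>+ y. ennreal \<bar>p t x y\<bar> \<partial>M) \<le> ennreal (c3 * A)" if t: "t > 0" for t x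
  proof -
    have "(\<integral>\<^sup>+ y. ennreal \<bar>p t x y\<bar> \<partial>M) \<le> (\<integral>\<^sup>+ y. ennreal c3 * ennreal (?G c4 t x y) \<partial>M)"
      using bound[OF t] c by (intro nn_integral_mono) (simp flip: ennreal_mult)
    also have "\<dots> = ennreal c3 * (\<integral>\<^sup>+ y. ennreal (?G c4 t x y) \<partial>M)"
    proof (rule nn_integral_cmult)
      have "continuous_on UNIV (\<lambda>y. (\<lambda>z. ?G c4 t (fst z) (snd z)) (x, y))"
        by (rule continuous_on_compose2[OF contG[OF t]]) (auto intro!: continuous_intros)
      then have "(\<lambda>y. ?G c4 t x y) \<in> borel_measurable M"
        using sets by (simp only: fst_conv snd_conv) (simp add: borel_measurable_continuous_onI cong: measurable_cong_sets)
      then show "(\<lambda>y. ennreal (?G c4 t x y)) \<in> borel_measurable M"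
        by measurable
    qed
    also have "\<dots> \<le> ennreal c3 * ennreal A"
      using A(2)[OF t] by (intro mult_left_mono) auto
    finally show ?thesis
      using c A by (simp add: ennreal_mult)
  qed
  have int: "integrable M (p t x)" if t: "t > 0" for t x
    using meas[OF t] le_less_trans[OF nn[OF t]] by (intro integrableI_bounded) auto
  have "(\<integral>y. \<bar>p t x y\<bar> \<partial>M) \<le> c3 * A" if t: "t > 0" for t x
  proof -
    have "ennreal (\<integral>y. \<bar>p t x y\<bar> \<partial>M) = (\<integral>\<^sup>+ y. ennreal \<bar>p t x y\<bar> \<partial>M)"
      using int[OF t] by (intro nn_integral_eq_integral[symmetric]) auto
    with nn[OF t] show ?thesis
      using c A by (metis ennreal_le_iff less_imp_le mult_pos_pos)
  qed
  moreover have "c3 * A > 0" using c A by simp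
  ultimately show ?thesis using int that by blast
qed

theorem proposition3p8:
  fixes M :: "'a::metric_space measure"
    and E :: "('a \<Rightarrow> real) \<Rightarrow> ('a \<Rightarrow> real) \<Rightarrow> real"
    and F :: "('a \<Rightarrow> real) set"
    and p :: "real \<Rightarrow> 'a \<Rightarrow> 'a \<Rightarrow> real"
    and dH dW \<kappa> :: real
    and n :: nat
  assumes "sub_gaussian_dirichlet_space M E F p dH dW"
    and "0 < \<kappa>" and "\<kappa> < dW"
    and "wBE M dist p dW \<kappa>"
    and "n \<ge> 1"
  shows "wBE (power_measure n M) (power_dist n dW) (power_kernel n p) dW \<kappa>"
proof -
  have sets: "sets M = sets borel" and reg: "ahlfors_regular M dH" and dW: "dW > 2"
    using assms(1) unfolding sub_gaussian_dirichlet_space_def radon_measure_def by auto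
  have sf: "sigma_finite_measure M"
    by (rule ahlfors_regular_sigma_finite[OF sets reg])
  obtain A where "A > 0" "\<And>t x. t > 0 \<Longrightarrow> integrable M (p t x)"
    "\<And>t x. t > 0 \<Longrightarrow> (\<integral>y. \<bar>p t x y\<bar> \<partial>M) \<le> A"
    using sub_gaussian_kernel_L1_bound[OF assms(1) sf] by blast
  then show ?thesis
    using dW sets_eq_imp_space_eq[OF sets] assms(2,4,5) by (intro wBE_power[OF sf]) auto
qed

end
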